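(* Let $(X,T)$ be a totally transitive, weakly rigid cascade. Then $X$ is connected.
   Context: A cascade $(X,T)$ is a homeomorphism $T$ of a compact Hausdorff space $X$ (not necessarily metrizable). It is transitive if for all nonempty open $U,V\subset X$ there is $i\in\mathbb{Z}$ with $U\cap T^{-i}(V)\neq\emptyset$. It is totally transitive if $(X,T^n)$ is transitive for every integer $n\neq 0$. For a cascade $(Y,S)$ and $y\in Y$, let $\omega(y)=\bigcap_{N\ge 1}\overline{\{S^i y: i\ge N\}}$ and $\alpha(y)=\bigcap_{N\ge1}\overline{\{S^{i}y: i\le -N\}}$. A point $y$ is recurrent if $y\in\alpha(y)\cup\omega(y)$. The enveloping semigroup $E(X)$ is the closure of $\{T^i : i \in \mathbb{Z}\}$ in $X^X$ (product topology), regarded as a cascade under $T_* : p \mapsto T\circ p$. $(X,T)$ is weakly rigid if $\mathrm{Id}_X$ is a recurrent point of $(E(X),T_* )$. Connected means not the union of two disjoint nonempty open subsets. *)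

theory Defs
  imports "HOL-Analysis.Analysis"
begin

text \<open>Spaces are values of type 'a topology, so that the same notions apply to a
  space and to its enveloping semigroup. The empty space is allowed.\<close>

definition cascade :: "'a topology \<Rightarrow> ('a \<Rightarrow> 'a) \<Rightarrow> bool" where
  "cascade X T \<longleftrightarrow> compact_space X \<and> Hausdorff_space X \<and> homeomorphic_map X X T"

text \<open>The integer power of a bijection of the underlying set. The values of \<open>T\<close> outside the
  space are arbitrary, so the inverse is taken relative to the space.\<close>

definition zpow :: "'a topology \<Rightarrow> ('a \<Rightarrow> 'a) \<Rightarrow> int \<Rightarrow> 'a \<Rightarrow> 'a" where
  "zpow X T i = (if 0 \<le> i then T ^^ nat i else inv_into (topspace X) T ^^ nat (- i))"

definition transitive :: "'a topology \<Rightarrow> ('a \<Rightarrow> 'a) \<Rightarrow> bool" where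
  "transitive X T \<longleftrightarrow>
     (\<forall>U V. openin X U \<and> U \<noteq> {} \<and> openin X V \<and> V \<noteq> {} \<longrightarrow>
        (\<exists>i::int. U \<inter> zpow X T (- i) ` V \<noteq> {}))"

definition totally_transitive :: "'a topology \<Rightarrow> ('a \<Rightarrow> 'a) \<Rightarrow> bool" where
  "totally_transitive X T \<longleftrightarrow> (\<forall>n::int. n \<noteq> 0 \<longrightarrow> transitive X (zpow X T n))"

definition omega_limit :: "'a topology \<Rightarrow> ('a \<Rightarrow> 'a) \<Rightarrow> 'a \<Rightarrow> 'a set" where
  "omega_limit Y S y = (\<Inter>N\<in>{1::int..}. Y closure_of {zpow Y S i y | i. i \<ge> N})"

definition alpha_limit :: "'a topology \<Rightarrow> ('a \<Rightarrow> 'a) \<Rightarrow> 'a \<Rightarrow> 'a set" where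
  "alpha_limit Y S y = (\<Inter>N\<in>{1::int..}. Y closure_of {zpow Y S i y | i. i \<le> - N})"

definition recurrent :: "'a topology \<Rightarrow> ('a \<Rightarrow> 'a) \<Rightarrow> 'a \<Rightarrow> bool" where
  "recurrent Y S y \<longleftrightarrow> y \<in> alpha_limit Y S y \<union> omega_limit Y S y"

text \<open>The points of the product topology on \<open>X\<^sup>X\<close> are the maps that are \<open>undefined\<close> outside
  the space, hence the restrictions below.\<close>

abbreviation self_maps :: "'a topology \<Rightarrow> ('a \<Rightarrow> 'a) topology" where
  "self_maps X \<equiv> product_topology (\<lambda>_. X) (topspace X)"

definition enveloping_semigroup :: "'a topology \<Rightarrow> ('a \<Rightarrow> 'a) \<Rightarrow> ('a \<Rightarrow> 'a) topology" where
  "enveloping_semigroup X T =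
     subtopology (self_maps X)
       (self_maps X closure_of {restrict (zpow X T i) (topspace X) | i. True})"

definition post_comp :: "'a topology \<Rightarrow> ('a \<Rightarrow> 'a) \<Rightarrow> ('a \<Rightarrow> 'a) \<Rightarrow> ('a \<Rightarrow> 'a)" where
  "post_comp X T p = restrict (T \<circ> p) (topspace X)"

definition weakly_rigid :: "'a topology \<Rightarrow> ('a \<Rightarrow> 'a) \<Rightarrow> bool" where
  "weakly_rigid X T \<longleftrightarrow>
     recurrent (enveloping_semigroup X T) (post_comp X T) (restrict id (topspace X))"

lemma zpow_maps:
  assumes c: "homeomorphic_map X X T"
  shows zpow_cont: "continuous_map X X (zpow X T i)"
    and zpow_Suc: "x \<in> topspace X \<Longrightarrow> T (zpow X T i x) = zpow X T (i + 1) x"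
    and zpow_pred: "x \<in> topspace X \<Longrightarrow> inv_into (topspace X) T (zpow X T i x) = zpow X T (i - 1) x"
proof -
  let ?S = "inv_into (topspace X) T"
  have surj: "T ` topspace X = topspace X" and inj: "inj_on T (topspace X)"
    using c by (auto simp: homeomorphic_eq_everything_map)
  have cT: "continuous_map X X T" using c by (simp add: homeomorphic_eq_everything_map)
  have TS: "T (?S x) = x" if "x \<in> topspace X" for x using that surj by (metis f_inv_into_f)
  have ST: "?S (T x) = x" if "x \<in> topspace X" for x using that inj by simp
  obtain g where g: "homeomorphic_maps X X T g" using c homeomorphic_map_maps by blast
  have "g x = ?S x" if "x \<in> topspace X" for x
  proof -
    have "?S x \<in> topspace X" using that surj by (simp add: inv_into_into)
    then have "g (T (?S x)) = ?S x" using g by (simp add: homeomorphic_maps_def)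
    then show ?thesis using TS[OF that] by simp
  qed
  then have cS: "continuous_map X X ?S"
    using g by (auto simp: homeomorphic_maps_def intro: continuous_map_eq[of X X g])
  have pw: "continuous_map X X (f ^^ n)" if "continuous_map X X f" for f :: "'a \<Rightarrow> 'a" and n
  proof (induction n)
    case (Suc n)
    show ?case using continuous_map_compose[OF Suc that] by (simp add: o_def)
  qed (simp add: id_def)
  show C: "continuous_map X X (zpow X T i)" for i
    unfolding zpow_def using pw cT cS by auto
  show A: "T (zpow X T i x) = zpow X T (i + 1) x" if "x \<in> topspace X" for i x
  proof (cases "i \<ge> 0")
    case True then show ?thesis by (simp add: zpow_def nat_add_distrib)
  next
    case False
    then have e: "nat (- i) = Suc (nat (- (i + 1)))" by simp
    have "(?S ^^ nat (- (i + 1))) x \<in> topspace X"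
      using continuous_map_image_subset_topspace[OF pw[OF cS]] that by blast
    then show ?thesis using False TS by (auto simp: zpow_def e simp del: nat_eq_iff)
  qed
  show "?S (zpow X T i x) = zpow X T (i - 1) x" if "x \<in> topspace X"
  proof -
    have "zpow X T (i - 1) x \<in> topspace X"
      using continuous_map_image_subset_topspace[OF C] that by blast
    then show ?thesis using A[OF that, of "i - 1"] ST[of "zpow X T (i - 1) x"] by simp
  qed
qed

lemma post_comp_cont:
  assumes "continuous_map X X f"
  shows "continuous_map (self_maps X) (self_maps X) (post_comp X f)"
  unfolding continuous_map_componentwise
proof (intro conjI ballI)
  show "post_comp X f ` topspace (self_maps X) \<subseteq> extensional (topspace X)"
    by (auto simp: post_comp_def)
  fix k assume k: "k \<in> topspace X"
  have "continuous_map (self_maps X) X (f \<circ> (\<lambda>p. p k))"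
    using continuous_map_product_projection[OF k, of "\<lambda>_. X"] assms by (rule continuous_map_compose)
  then show "continuous_map (self_maps X) X (\<lambda>x. post_comp X f x k)"
    using k by (simp add: post_comp_def o_def)
qed

text \<open>The two facts below confirm that the encoding is the intended one: left composition with
  \<open>T\<close> makes the enveloping semigroup a cascade, and the orbit of the identity consists of the
  powers of \<open>T\<close>.\<close>

lemma cascade_enveloping_semigroup:
  assumes "cascade X T"
  shows "cascade (enveloping_semigroup X T) (post_comp X T)"
proof -
  let ?S = "inv_into (topspace X) T"
  let ?O = "{restrict (zpow X T i) (topspace X) | i. True}"
  let ?C = "self_maps X closure_of ?O"
  have h: "homeomorphic_map X X T" using assms by (simp add: cascade_def)
  have surj: "T ` topspace X = topspace X" and inj: "inj_on T (topspace X)"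
    using h by (auto simp: homeomorphic_eq_everything_map)
  have cT: "continuous_map X X T" using h by (simp add: homeomorphic_eq_everything_map)
  have "zpow X T (-1) = ?S" by (simp add: zpow_def)
  then have cS: "continuous_map X X ?S" using zpow_cont[OF h, of "-1"] by simp
  have T1: "post_comp X T ` ?O \<subseteq> ?O"
    using zpow_Suc[OF h] by (auto simp: post_comp_def fun_eq_iff restrict_def)
  have S1: "post_comp X ?S ` ?O \<subseteq> ?O"
    using zpow_pred[OF h] by (auto simp: post_comp_def fun_eq_iff restrict_def)
  have top: "topspace (enveloping_semigroup X T) = ?C"
    by (simp add: enveloping_semigroup_def closure_of_subset_topspace inf.absorb2 del: topspace_product_topology)
  have pt: "p x \<in> topspace X" "p \<in> extensional (topspace X)" if "p \<in> ?C" "x \<in> topspace X" for p x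
    using that closure_of_subset_topspace[of "self_maps X" ?O] by (auto simp: PiE_def)
  have pe: "p \<in> extensional (topspace X)" if "p \<in> ?C" for p
    using that closure_of_subset_topspace[of "self_maps X" ?O] by (auto simp: PiE_def)
  have E: "continuous_map (enveloping_semigroup X T) (enveloping_semigroup X T) (post_comp X f)"
    if "continuous_map X X f" "post_comp X f ` ?O \<subseteq> ?O" for f
  proof -
    have "post_comp X f ` ?C \<subseteq> ?C"
      using continuous_map_image_closure_subset[OF post_comp_cont[OF that(1)]] closure_of_mono[OF that(2)]
      by blast
    moreover have "continuous_map (enveloping_semigroup X T) (self_maps X) (post_comp X f)"
      unfolding enveloping_semigroup_def
      by (rule continuous_map_from_subtopology[OF post_comp_cont[OF that(1)]])
    ultimately show ?thesis
      using top by (subst (2) enveloping_semigroup_def) (auto simp: continuous_map_in_subtopology)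
  qed
  have "homeomorphic_maps (enveloping_semigroup X T) (enveloping_semigroup X T)
          (post_comp X T) (post_comp X ?S)"
    unfolding homeomorphic_maps_def
  proof (intro conjI ballI E cT cS T1 S1)
    fix p assume "p \<in> topspace (enveloping_semigroup X T)"
    then have p: "p \<in> ?C" using top by simp
    show "post_comp X ?S (post_comp X T p) = p"
      by (rule extensionalityI[of _ "topspace X"]) (use pe[OF p] pt[OF p] inj in \<open>auto simp: post_comp_def\<close>)
    show "post_comp X T (post_comp X ?S p) = p"
      by (rule extensionalityI[of _ "topspace X"])
        (use pe[OF p] pt[OF p] surj in \<open>auto simp: post_comp_def f_inv_into_f\<close>)
  qed
  moreover have "compact_space (enveloping_semigroup X T)"
    unfolding enveloping_semigroup_def
    by (intro compact_space_subtopology closedin_compact_space closedin_closure_of)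
      (use assms in \<open>simp add: compact_space_product_topology cascade_def\<close>)
  moreover have "Hausdorff_space (enveloping_semigroup X T)"
    unfolding enveloping_semigroup_def
    by (intro Hausdorff_space_subtopology) (use assms in \<open>simp add: Hausdorff_space_product_topology cascade_def\<close>)
  ultimately show ?thesis unfolding cascade_def homeomorphic_map_maps by blast
qed

lemma zpow_post_comp:
  assumes "cascade X T"
  shows "zpow (enveloping_semigroup X T) (post_comp X T) i (restrict id (topspace X))
         = restrict (zpow X T i) (topspace X)"
proof -
  let ?E = "enveloping_semigroup X T"
  let ?P = "zpow ?E (post_comp X T)" and ?Id = "restrict id (topspace X)"
  let ?R = "\<lambda>i. restrict (zpow X T i) (topspace X)"
  have h: "homeomorphic_map X X T" and H: "homeomorphic_map ?E ?E (post_comp X T)"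
    using assms cascade_enveloping_semigroup[OF assms] by (simp_all add: cascade_def)
  have R: "?R i \<in> topspace ?E" for i
  proof -
    have "{?R i | i. True} \<subseteq> topspace (self_maps X)"
      using continuous_map_image_subset_topspace[OF zpow_cont[OF h]] by fastforce
    from closure_of_subset[OF this] this show ?thesis
      unfolding enveloping_semigroup_def topspace_subtopology by blast
  qed
  have step: "post_comp X T (?R i) = ?R (i + 1)" for i
    using zpow_Suc[OF h] by (auto simp: post_comp_def fun_eq_iff)
  have Id: "?Id = ?R 0" by (simp add: zpow_def)
  show ?thesis
  proof (induction i rule: int_induct[where k = 0])
    case base
    show ?case by (simp add: zpow_def)
  next
    case (step1 i)
    have "?P (i + 1) ?Id = post_comp X T (?P i ?Id)"
      unfolding Id by (rule zpow_Suc[OF H R, symmetric])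
    then show ?case unfolding step1.IH step .
  next
    case (step2 i)
    have "inv_into (topspace ?E) (post_comp X T) (?R i) = ?R (i - 1)"
      using inv_into_f_f[OF homeomorphic_imp_injective_map[OF H] R[of "i - 1"]] step[of "i - 1"]
      by (simp only: diff_add_cancel)
    moreover have "?P (i - 1) ?Id = inv_into (topspace ?E) (post_comp X T) (?P i ?Id)"
      unfolding Id by (rule zpow_pred[OF H R, symmetric])
    ultimately show ?case unfolding step2.IH by (rule trans[rotated])
  qed
qed

end

theory Submission
  imports Defs
begin

text \<open>Let \<open>A\<close> be clopen and read the itinerary of a point \<open>x\<close> as the two-sided sequence of truth
  values of \<open>T\<^sup>i x \<in> A\<close>. Weak rigidity, tested on two coordinates of \<open>X\<^sup>X\<close>, says that any two
  points return simultaneously, in positive time say, close to where they started. Since \<open>A\<close> is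
  clopen, two points with the same itinerary at all positive times then lie on the same side of
  \<open>A\<close>: in the subshift of itineraries there is no asymptotic pair. This makes the subshift finite:
  by compactness finitely many positive times \<open>1, \<dots>, N\<close> already decide membership in \<open>A\<close>
  (\<open>finite_future_determines_present\<close>), hence decide the entire past
  (\<open>finite_future_determines_past\<close>), so that the translates of \<open>A\<close> lie in a finite Boolean
  algebra and two of them coincide (\<open>clopen_periodic\<close>). Thus \<open>A\<close> is invariant under some \<open>T\<^sup>m\<close> with
  \<open>m \<noteq> 0\<close>, and transitivity of \<open>T\<^sup>m\<close> forces \<open>A\<close> to be trivial.

  The return times are positive or negative according to whether the identity lies in its
  omega- or its alpha-limit set. To treat both cases at once, the argument is carried out
  for an action of the integers, which may be reversed in time.\<close>

section \<open>Clopen sets under an action of the integers with pairwise returns\<close>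

definition pairwise_returns :: "'a topology \<Rightarrow> (int \<Rightarrow> 'a \<Rightarrow> 'a) \<Rightarrow> bool" where
  "pairwise_returns X h \<longleftrightarrow> (\<forall>x y U V. openin X U \<and> x \<in> U \<and> openin X V \<and> y \<in> V \<longrightarrow>
     (\<exists>i\<ge>1. h i x \<in> U \<and> h i y \<in> V))"

locale int_action =
  fixes X :: "'a topology" and h :: "int \<Rightarrow> 'a \<Rightarrow> 'a"
  assumes cont: "continuous_map X X (h i)"
    and zero: "x \<in> topspace X \<Longrightarrow> h 0 x = x"
    and add: "x \<in> topspace X \<Longrightarrow> h (i + j) x = h i (h j x)"
begin

lemma closed: "x \<in> topspace X \<Longrightarrow> h i x \<in> topspace X"
  using continuous_map_image_subset_topspace[OF cont] by blast

lemma reversed: "int_action X (\<lambda>i. h (- i))"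
  using cont zero add[of _ "- i" "- j" for i j] by unfold_locales simp_all

lemma homeomorphic: "homeomorphic_map X X (h i)"
proof -
  have "homeomorphic_maps X X (h i) (h (- i))"
    using cont zero add[of _ i "- i"] add[of _ "- i" i] by (simp add: homeomorphic_maps_def)
  then show ?thesis
    using homeomorphic_map_maps by blast
qed

text \<open>The pairs whose first point lies in \<open>A\<close>, whose second point does not, and whose itineraries
  agree at the times \<open>1, \<dots>, n\<close> form a decreasing sequence of closed subsets of \<open>X \<times> X\<close>. A pair in
  all of them could not return simultaneously to \<open>A \<times> (X - A)\<close>, so one of the sets is empty.\<close>

lemma finite_future_determines_present:
  assumes comp: "compact_space X" and clopen: "openin X A" "closedin X A"
    and returns: "pairwise_returns X h"
  shows "\<exists>n. \<forall>x\<in>topspace X. \<forall>y\<in>topspace X.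
    (\<forall>i\<in>{1..int n}. h i x \<in> A \<longleftrightarrow> h i y \<in> A) \<longrightarrow> (x \<in> A \<longleftrightarrow> y \<in> A)"
proof -
  let ?B = "topspace X - A"
  define D where "D n = (A \<times> ?B) \<inter>
    {p \<in> topspace (prod_topology X X). \<forall>i\<in>{1..int n}. h i (fst p) \<in> A \<longleftrightarrow> h i (snd p) \<in> A}" for n
  have B: "openin X ?B" "closedin X ?B"
    using clopen by auto
  have "\<exists>n. D n = {}"
  proof (rule ccontr)
    assume "\<not> ?thesis"
    then have ne: "D n \<noteq> {}" for n by blast
    have agree: "closedin (prod_topology X X)
        {p \<in> topspace (prod_topology X X). h i (fst p) \<in> A \<longleftrightarrow> h i (snd p) \<in> A}" for i
    proof -
      have c1: "continuous_map (prod_topology X X) X (\<lambda>p. h i (fst p))"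
        and c2: "continuous_map (prod_topology X X) X (\<lambda>p. h i (snd p))"
        using continuous_map_compose[OF continuous_map_fst cont]
          continuous_map_compose[OF continuous_map_snd cont] by (auto simp: o_def)
      have "{p \<in> topspace (prod_topology X X). h i (fst p) \<in> A \<longleftrightarrow> h i (snd p) \<in> A} =
        ({p \<in> topspace (prod_topology X X). h i (fst p) \<in> A} \<inter>
          {p \<in> topspace (prod_topology X X). h i (snd p) \<in> A}) \<union>
        ({p \<in> topspace (prod_topology X X). h i (fst p) \<in> ?B} \<inter>
          {p \<in> topspace (prod_topology X X). h i (snd p) \<in> ?B})"
        using closed by auto
      moreover have "closedin (prod_topology X X) \<dots>"
        by (intro closedin_Un closedin_Int closedin_continuous_map_preimage[OF c1]
            closedin_continuous_map_preimage[OF c2] clopen B)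
      ultimately show ?thesis by simp
    qed
    have D_eq: "D n = (A \<times> ?B) \<inter> (\<Inter>i\<in>{1..int n}.
        {p \<in> topspace (prod_topology X X). h i (fst p) \<in> A \<longleftrightarrow> h i (snd p) \<in> A})" for n
      using closedin_subset[OF clopen(2)] by (auto simp: D_def)
    have AB: "closedin (prod_topology X X) (A \<times> ?B)"
      using clopen(2) B(2) by (simp add: closedin_prod_Times_iff)
    have "closedin (prod_topology X X) (D n)" for n
    proof (cases "n = 0")
      case False
      then show ?thesis
        unfolding D_eq by (intro closedin_Int AB closedin_INT agree) auto
    qed (use AB D_eq in simp)
    moreover have "decseq D"
      by (auto simp: decseq_def D_def)
    moreover have "compact_space (prod_topology X X)"
      using comp by (simp add: compact_space_prod_topology)
    ultimately obtain p where p: "\<And>n. p \<in> D n"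
      using compact_space_imp_nest[of "prod_topology X X" D] ne by blast
    obtain x y where xy: "p = (x, y)" "x \<in> A" "y \<in> ?B"
      using p[of 0] by (cases p) (auto simp: D_def)
    obtain i where i: "i \<ge> 1" "h i x \<in> A" "h i y \<in> ?B"
      using returns[unfolded pairwise_returns_def, rule_format, of A x ?B y] clopen(1) B(1) xy(2,3)
      by auto
    then show False
      using p[of "nat i"] xy by (auto simp: D_def)
  qed
  then obtain n where n: "D n = {}" ..
  have half: "y \<in> A" if "x \<in> topspace X" "y \<in> topspace X" "x \<in> A"
      and "\<forall>i\<in>{1..int n}. h i x \<in> A \<longleftrightarrow> h i y \<in> A" for x y
  proof (rule ccontr)
    assume "y \<notin> A"
    with that have "(x, y) \<in> D n" by (auto simp: D_def)
    with n show False by simp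
  qed
  then have "x \<in> A \<longleftrightarrow> y \<in> A" if "x \<in> topspace X" "y \<in> topspace X"
      and "\<forall>i\<in>{1..int n}. h i x \<in> A \<longleftrightarrow> h i y \<in> A" for x y
    using that by metis
  then show ?thesis
    by blast
qed

text \<open>Moving the window \<open>1, \<dots>, n\<close> back one step at a time, the value just before the window is
  determined at each step.\<close>

lemma finite_future_determines_past:
  fixes n :: nat
  assumes det: "\<forall>x\<in>topspace X. \<forall>y\<in>topspace X.
      (\<forall>i\<in>{1..int n}. h i x \<in> A \<longleftrightarrow> h i y \<in> A) \<longrightarrow> (x \<in> A \<longleftrightarrow> y \<in> A)"
    and x: "x \<in> topspace X" and y: "y \<in> topspace X"
    and agree: "\<forall>i\<in>{1..int n}. h i x \<in> A \<longleftrightarrow> h i y \<in> A"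
    and i: "i \<le> int n"
  shows "h i x \<in> A \<longleftrightarrow> h i y \<in> A"
proof -
  have window: "\<forall>i\<in>{1 - int j..int n}. h i x \<in> A \<longleftrightarrow> h i y \<in> A" for j
  proof (induction j)
    case (Suc j)
    let ?x = "h (- int j) x" and ?y = "h (- int j) y"
    have "?x \<in> A \<longleftrightarrow> ?y \<in> A"
      by (rule det[rule_format]) (use Suc x y in \<open>auto simp: closed simp flip: add\<close>)
    then have "h i x \<in> A \<longleftrightarrow> h i y \<in> A" if "i = - int j" for i
      using that by simp
    moreover have "i = - int j \<or> i \<in> {1 - int j..int n}" if "i \<in> {1 - int (Suc j)..int n}" for i
      using that by auto
    ultimately show ?case
      using Suc by blast
  qed (use agree in simp)
  show ?thesis
    using window[of "nat (1 - i)"] i by auto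
qed

text \<open>Each translate of \<open>A\<close> into the past is a union of classes of points with the same itinerary on
  \<open>1, \<dots>, n\<close>. There are finitely many such unions, so two of the translates coincide.\<close>

lemma clopen_periodic:
  assumes "compact_space X" "openin X A" "closedin X A" "pairwise_returns X h"
  shows "\<exists>m. m \<noteq> 0 \<and> (\<forall>x\<in>topspace X. h m x \<in> A \<longleftrightarrow> x \<in> A)"
proof -
  obtain n where det: "\<forall>x\<in>topspace X. \<forall>y\<in>topspace X.
      (\<forall>i\<in>{1..int n}. h i x \<in> A \<longleftrightarrow> h i y \<in> A) \<longrightarrow> (x \<in> A \<longleftrightarrow> y \<in> A)"
    using finite_future_determines_present[OF assms] ..
  define code where "code x = {i \<in> {1..int n}. h i x \<in> A}" for x
  define P where "P j = code ` {x \<in> topspace X. h (- int j) x \<in> A}" for j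
  have past: "h (- int j) x \<in> A \<longleftrightarrow> h (- int j) y \<in> A"
    if "x \<in> topspace X" "y \<in> topspace X" "code x = code y" for x y j
  proof (rule finite_future_determines_past[OF det that(1,2)])
    have "h i x \<in> A \<longleftrightarrow> h i y \<in> A" if "i \<in> {1..int n}" for i
    proof -
      have "i \<in> code x \<longleftrightarrow> i \<in> code y"
        using \<open>code x = code y\<close> by simp
      then show ?thesis
        using that by (simp add: code_def)
    qed
    then show "\<forall>i\<in>{1..int n}. h i x \<in> A \<longleftrightarrow> h i y \<in> A" ..
  qed simp
  have P: "h (- int j) x \<in> A \<longleftrightarrow> code x \<in> P j" if "x \<in> topspace X" for x j
  proof
    assume "code x \<in> P j"
    then obtain y where "y \<in> topspace X" "h (- int j) y \<in> A" "code x = code y"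
      unfolding P_def by blast
    with past[OF that] show "h (- int j) x \<in> A" by blast
  qed (use that in \<open>simp add: P_def\<close>)
  have "range P \<subseteq> Pow (Pow {1..int n})"
    by (auto simp: P_def code_def)
  then have "finite (range P)"
    by (rule finite_subset) simp
  then have "\<not> inj P"
    using finite_imageD by blast
  then obtain j k where jk: "P j = P k" "j \<noteq> k"
    by (auto simp: inj_on_def)
  show ?thesis
  proof (intro exI[of _ "int k - int j"] conjI ballI)
    fix x assume x: "x \<in> topspace X"
    have "h (- int j) (h (int k) x) \<in> A \<longleftrightarrow> h (- int k) (h (int k) x) \<in> A"
      using P[OF closed[OF x], of j k] P[OF closed[OF x], of k k] jk(1) by simp
    then show "h (int k - int j) x \<in> A \<longleftrightarrow> x \<in> A"
      using x by (simp add: zero flip: add)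
  qed (use jk(2) in simp)
qed

end


section \<open>Powers, transitivity and weak rigidity\<close>

lemma zpow_int_action:
  assumes T: "homeomorphic_map X X T"
  shows "int_action X (zpow X T)"
proof
  show "continuous_map X X (zpow X T i)" for i
    by (rule zpow_cont[OF T])
  show "zpow X T 0 x = x" for x
    by (simp add: zpow_def)
  fix x i j assume x: "x \<in> topspace X"
  have y: "zpow X T j x \<in> topspace X"
    using continuous_map_image_subset_topspace[OF zpow_cont[OF T]] x by blast
  show "zpow X T (i + j) x = zpow X T i (zpow X T j x)"
  proof (induction i rule: int_induct[where k = 0])
    case base
    show ?case by (simp add: zpow_def)
  next
    case (step1 i)
    then show ?case
      using zpow_Suc[OF T x, of "i + j"] zpow_Suc[OF T y, of i] by (simp add: ac_simps)
  next
    case (step2 i)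
    have "zpow X T (i - 1 + j) x = inv_into (topspace X) T (zpow X T (i + j) x)"
      using zpow_pred[OF T x, of "i + j"] by (simp add: algebra_simps)
    also have "\<dots> = zpow X T (i - 1) (zpow X T j x)"
      unfolding step2.IH by (rule zpow_pred[OF T y])
    finally show ?case .
  qed
qed

lemma transitive_invariant_clopen_trivial:
  assumes S: "homeomorphic_map X X S" and tr: "transitive X S"
    and clopen: "openin X A" "closedin X A"
    and inv: "\<forall>x\<in>topspace X. S x \<in> A \<longleftrightarrow> x \<in> A"
  shows "A = {} \<or> A = topspace X"
proof (rule ccontr)
  assume nontrivial: "\<not> ?thesis"
  interpret int_action X "zpow X S"
    by (rule zpow_int_action[OF S])
  have invariant: "zpow X S i x \<in> A \<longleftrightarrow> x \<in> A" if x: "x \<in> topspace X" for i x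
  proof (induction i rule: int_induct[where k = 0])
    case base
    show ?case using zero x by simp
  next
    case (step1 i)
    then show ?case using zpow_Suc[OF S x, of i] inv closed[OF x] by metis
  next
    case (step2 i)
    then show ?case using zpow_Suc[OF S x, of "i - 1"] inv closed[OF x] by (metis diff_add_cancel)
  qed
  have "openin X (topspace X - A)" "topspace X - A \<noteq> {}" "A \<noteq> {}"
    using clopen nontrivial closedin_subset by auto
  then obtain i where "A \<inter> zpow X S (- i) ` (topspace X - A) \<noteq> {}"
    using tr[unfolded transitive_def, rule_format, of A "topspace X - A"] clopen(1) by blast
  then show False
    using invariant by blast
qed

text \<open>Membership of the identity in the closure of a set of powers of \<open>T\<close> is tested here on basic open
  sets of \<open>X\<^sup>X\<close> that constrain two coordinates.\<close>

lemma identity_in_closure_pairwise_return: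
  assumes cl: "restrict id (topspace X) \<in>
      enveloping_semigroup X T closure_of {restrict (zpow X T i) (topspace X) | i. Q i}"
    and U: "openin X U" "x \<in> U" and V: "openin X V" "y \<in> V"
  shows "\<exists>i. Q i \<and> zpow X T i x \<in> U \<and> zpow X T i y \<in> V"
proof -
  let ?E = "enveloping_semigroup X T"
  have x: "x \<in> topspace X" and y: "y \<in> topspace X"
    using U V openin_subset by blast+
  have coord: "continuous_map ?E X (\<lambda>p. p z)" if "z \<in> topspace X" for z
    unfolding enveloping_semigroup_def
    by (rule continuous_map_from_subtopology[OF continuous_map_product_projection[OF that]])
  let ?W = "{p \<in> topspace ?E. p x \<in> U} \<inter> {p \<in> topspace ?E. p y \<in> V}"
  have "openin ?E ?W"
    by (intro openin_Int openin_continuous_map_preimage[OF coord[OF x]]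
        openin_continuous_map_preimage[OF coord[OF y]] U V)
  moreover have "restrict id (topspace X) \<in> ?W"
    using cl U V x y by (auto simp: in_closure_of)
  ultimately have "\<exists>p. p \<in> {restrict (zpow X T i) (topspace X) | i. Q i} \<and> p \<in> ?W"
    by (intro conjunct2[OF cl[unfolded in_closure_of], rule_format] conjI)
  then show ?thesis
    using x y by auto
qed

text \<open>The limit sets are contained in the closures of the tails \<open>i \<ge> 1\<close> and \<open>i \<le> -1\<close> of the orbit of
  the identity, and these tails exclude the trivial return at time \<open>0\<close>.\<close>

lemma weakly_rigid_pairwise_returns:
  assumes c: "cascade X T" and wr: "weakly_rigid X T"
  shows "pairwise_returns X (zpow X T) \<or> pairwise_returns X (\<lambda>i. zpow X T (- i))"
proof -
  let ?Id = "restrict id (topspace X)" and ?E = "enveloping_semigroup X T"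
  let ?R = "\<lambda>i. restrict (zpow X T i) (topspace X)"
  have "?Id \<in> ?E closure_of {?R i | i. i \<ge> 1} \<or> ?Id \<in> ?E closure_of {?R i | i. i \<le> - 1}"
    using wr unfolding weakly_rigid_def recurrent_def alpha_limit_def omega_limit_def
      zpow_post_comp[OF c] by fastforce
  then show ?thesis
  proof (elim disj_forward)
    assume cl: "?Id \<in> ?E closure_of {?R i | i. i \<ge> 1}"
    show "pairwise_returns X (zpow X T)"
      unfolding pairwise_returns_def using identity_in_closure_pairwise_return[OF cl] by blast
  next
    assume cl: "?Id \<in> ?E closure_of {?R i | i. i \<le> - 1}"
    show "pairwise_returns X (\<lambda>i. zpow X T (- i))"
      unfolding pairwise_returns_def
    proof (intro allI impI, elim conjE)
      fix x y U V assume "openin X U" "x \<in> U" "openin X V" "y \<in> V"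
      then obtain i where "i \<le> - 1" "zpow X T i x \<in> U" "zpow X T i y \<in> V"
        using identity_in_closure_pairwise_return[OF cl] by blast
      then show "\<exists>i\<ge>1. zpow X T (- i) x \<in> U \<and> zpow X T (- i) y \<in> V"
        by (intro exI[of _ "- i"]) simp
    qed
  qed
qed


section \<open>Connectedness\<close>

theorem theorem3p6:
  fixes X :: "'a topology" and T :: "'a \<Rightarrow> 'a"
  assumes "cascade X T"
    and "totally_transitive X T"
    and "weakly_rigid X T"
  shows "connected_space X"
  unfolding connected_space_clopen_in
proof (intro allI impI, elim conjE)
  fix A assume clopen: "openin X A" "closedin X A"
  have comp: "compact_space X" and T: "homeomorphic_map X X T"
    using assms(1) by (simp_all add: cascade_def)
  interpret int_action X "zpow X T"
    by (rule zpow_int_action[OF T])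
  interpret rev: int_action X "\<lambda>i. zpow X T (- i)"
    by (rule reversed)
  obtain m where m: "m \<noteq> 0" "\<forall>x\<in>topspace X. zpow X T m x \<in> A \<longleftrightarrow> x \<in> A"
    using weakly_rigid_pairwise_returns[OF assms(1,3)]
  proof
    assume "pairwise_returns X (zpow X T)"
    from clopen_periodic[OF comp clopen this] that show thesis by blast
  next
    assume "pairwise_returns X (\<lambda>i. zpow X T (- i))"
    from rev.clopen_periodic[OF comp clopen this] obtain k
      where "k \<noteq> 0" "\<forall>x\<in>topspace X. zpow X T (- k) x \<in> A \<longleftrightarrow> x \<in> A" by blast
    then show thesis
      by (intro that[of "- k"]) simp_all
  qed
  show "A = {} \<or> A = topspace X"
  proof (rule transitive_invariant_clopen_trivial[OF homeomorphic _ clopen m(2)])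
    show "transitive X (zpow X T m)"
      using assms(2) m(1) by (simp add: totally_transitive_def)
  qed
qed

end
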